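(* Let $\Lambda\subset\mathbb{C}$ be the Lévy dragon, let $S$ be a non-singular linear transformation on $\mathbb{C}$, i.e. $S(z)=\lambda z+\tau$ with $\lambda,\tau\in\mathbb{C}$, $\lambda\neq 0$, and let $S(\Lambda)$ be the transformed Lévy dragon. Then $S(\Lambda)$ also admits a revolving structure. Further, $\Lambda$ (with its revolving structure of base $1+i$, digit set $\{0,1,i,-1,-i\}$ and labeled directed graph $\mathcal{G}_{\rm L}$) and $S(\Lambda)$ have the same revolving pattern.
   Context: Lévy dragon: $\Lambda$ is the unique non-empty compact subset of $\mathbb{C}$ with $\Lambda=f_0(\Lambda)\cup f_1(\Lambda)$, where $f_0(z)=\frac{1-i}{2}z$ and $f_1(z)=\frac{1+i}{2}z+\frac{1-i}{2}$. The set $S(\Lambda)$ is the attractor of the planar iterated function system $\{S\circ f_0\circ S^{-1},\ S\circ f_1\circ S^{-1}\}$. Labeled directed graph: $\mathcal{G}=(\mathcal{V},\mathcal{E},\mathcal{L})$ consists of a finite set of nodes $\mathcal{V}$, a set $\mathcal{E}$ of directed edges (ordered pairs of nodes), and a map $\mathcal{L}$ that labels the nodes by elements of a finite alphabet. Revolving number: $x\in\mathbb{C}$ is a revolving number with base $b\in\mathbb{C}$, (finite) digit set $\mathcal{D}=\{\delta_1,\dots,\delta_d\}\subset\mathbb{C}$ and labeled directed graph $\mathcal{G}=(\mathcal{V},\mathcal{E},\mathcal{L})$ if: (1) $\mathcal{L}:\mathcal{V}\to\mathcal{D}$ labels the nodes with the digits; (2) $x=c\cdot\sum_{n=1}^{\infty}b^{-n}\delta_{j_n}$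 for a digit sequence $(\delta_{j_n})_{n\ge1}\in\mathcal{D}^{\mathbb{N}}$ and some constant $c\in\mathbb{C}$; (3) there exists a sequence of nodes $(v_{j_n})_{n\ge 1}\in\mathcal{V}^{\mathbb{N}}$ such that $\mathcal{L}(v_{j_n})=\delta_{j_n}$ and $(v_{j_n},v_{j_{n+1}})\in\mathcal{E}$ for every $n\ge1$. Revolving structure: if $F$ is the attractor of a planar iterated function system and all points of $F$ are revolving numbers with base $b$, digit set $\mathcal{D}$ and labeled directed graph $\mathcal{G}$, then $F$ has (admits) a revolving structure with parameters $(b,\mathcal{D},\mathcal{G})$. Same revolving pattern: let $F_1,F_2$ be two planar sets with revolving structures with parameters $(b_1,\mathcal{D}_1,\mathcal{G}_1)$ and $(b_2,\mathcal{D}_2,\mathcal{G}_2)$. If $\mathcal{G}_1$ and $\mathcal{G}_2$ are defined by the same node set and the same edge set, so that they differ only in the labeling, then $F_1$ and $F_2$ have the same revolving pattern. The graph $\mathcal{G}_{\rm L}$: the node set is $\mathbb{Z}/4\mathbb{Z}\times\{0,1\}$ (8 nodes); there is a directed edge from $(q,\omega)$ to $(q',\omega')$ if and only if $q'=q+\omega$ in $\mathbb{Z}/4\mathbb{Z}$ (so exactly two edges start at each node); the node $(q,\omega)$ is labeled by the digit $\omega\, i^{q}\in\{0,1,i,-1,-i\}$. The Lévy dragon $\Lambda$ has a revolving structure with parameters $(1+i,\{0,1,i,-1,-i\},\mathcal{G}_{\rm L})$, its points being $\sum_{n=1}^{\infty}(1+i)^{-n}i^{\omega_1+\dots+\omega_{n-1}}\omega_n$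 with $(\omega_n)_{n\ge1}\in\{0,1\}^{\mathbb{N}}$. *)

theory Defs
  imports "HOL-Analysis.Analysis" "Graph_Theory.Pair_Digraph"
begin

definition planar_ifs :: "(complex \<Rightarrow> complex) set \<Rightarrow> bool" where
  "planar_ifs fs \<longleftrightarrow> finite fs \<and> fs \<noteq> {} \<and> (\<forall>f\<in>fs. \<exists>r<1. r-lipschitz_on UNIV f)"

text \<open>By Hutchinson's theorem, \<open>attractor fs\<close> is well defined whenever \<open>planar_ifs fs\<close> holds.\<close>

definition attractor :: "(complex \<Rightarrow> complex) set \<Rightarrow> complex set" where
  "attractor fs = (THE K. K \<noteq> {} \<and> compact K \<and> K = (\<Union>f\<in>fs. f ` K))"

definition levy_f0 :: "complex \<Rightarrow> complex" where
  "levy_f0 z = (1 - \<i>) / 2 * z"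

definition levy_f1 :: "complex \<Rightarrow> complex" where
  "levy_f1 z = (1 + \<i>) / 2 * z + (1 - \<i>) / 2"

definition levy_dragon :: "complex set" where
  "levy_dragon = attractor {levy_f0, levy_f1}"

text \<open>A labeled directed graph is a pair \<open>(G, L)\<close> of a digraph (nodes \<open>pverts G\<close>, edges
  \<open>parcs G\<close>, loops allowed) and a labeling \<open>L\<close>, of which only the values on \<open>pverts G\<close> matter.\<close>

type_synonym 'v labeled_digraph = "'v pair_pre_digraph \<times> ('v \<Rightarrow> complex)"

text \<open>The number \<open>x\<close> has a revolving expansion with the given constant \<open>c\<close>. Sequences start at
  index \<open>0\<close>, so that \<open>\<delta> n\<close> is the digit belonging to \<open>b\<close> to the power \<open>-(n + 1)\<close>.\<close>

definition revolving_expansion ::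
  "complex \<Rightarrow> complex \<Rightarrow> complex set \<Rightarrow> 'v labeled_digraph \<Rightarrow> complex \<Rightarrow> bool" where
  "revolving_expansion c b D = (\<lambda>(G, L) x.
     b \<noteq> 0 \<and> finite D \<and> pair_fin_digraph G \<and> L \<in> pverts G \<rightarrow> D \<and>
     (\<exists>\<delta> :: nat \<Rightarrow> complex.
        (\<forall>n. \<delta> n \<in> D) \<and>
        summable (\<lambda>n. \<delta> n / b ^ Suc n) \<and>
        x = c * (\<Sum>n. \<delta> n / b ^ Suc n) \<and>
        (\<exists>v :: nat \<Rightarrow> 'v. \<forall>n. v n \<in> pverts G \<and> L (v n) = \<delta> n \<and> (v n, v (Suc n)) \<in> parcs G)))"

definition revolving_number ::
  "complex \<Rightarrow> complex set \<Rightarrow> 'v labeled_digraph \<Rightarrow> complex \<Rightarrow> bool" where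
  "revolving_number b D \<G> x \<longleftrightarrow> (\<exists>c. revolving_expansion c b D \<G> x)"

text \<open>The constant \<open>c\<close> is common to all points of \<open>F\<close>. If it could be chosen separately for
  each point, then a single nonzero revolving number would make all complex numbers revolving,
  by rescaling, and the notion would be void.\<close>

definition has_revolving_structure ::
  "complex set \<Rightarrow> complex \<Rightarrow> complex set \<Rightarrow> 'v labeled_digraph \<Rightarrow> bool" where
  "has_revolving_structure F b D \<G> \<longleftrightarrow>
     (\<exists>fs. planar_ifs fs \<and> F = attractor fs) \<and>
     (\<exists>c. \<forall>x\<in>F. revolving_expansion c b D \<G> x)"

lemma has_revolving_structure_imp_revolving_number:
  "has_revolving_structure F b D \<G> \<Longrightarrow> x \<in> F \<Longrightarrow> revolving_number b D \<G> x"
  unfolding has_revolving_structure_def revolving_number_def by blast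

definition same_revolving_pattern ::
  "complex set \<Rightarrow> complex \<Rightarrow> complex set \<Rightarrow> 'v labeled_digraph \<Rightarrow>
   complex set \<Rightarrow> complex \<Rightarrow> complex set \<Rightarrow> 'v labeled_digraph \<Rightarrow> bool" where
  "same_revolving_pattern F1 b1 D1 \<G>1 F2 b2 D2 \<G>2 \<longleftrightarrow>
     has_revolving_structure F1 b1 D1 \<G>1 \<and>
     has_revolving_structure F2 b2 D2 \<G>2 \<and>
     pverts (fst \<G>1) = pverts (fst \<G>2) \<and>
     parcs (fst \<G>1) = parcs (fst \<G>2)"

text \<open>Elements of the integers modulo 4 are represented by their residues in \<open>{..<4}\<close>.\<close>

definition levy_digraph :: "(nat \<times> nat) pair_pre_digraph" where
  "levy_digraph =
     \<lparr> pverts = {..<4} \<times> {0, 1},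
       parcs = {((q, \<omega>), (q', \<omega>')) | q \<omega> q' \<omega>'.
         (q, \<omega>) \<in> {..<4} \<times> {0, 1} \<and> (q', \<omega>') \<in> {..<4} \<times> {0, 1} \<and> q' = (q + \<omega>) mod 4} \<rparr>"

definition levy_label :: "nat \<times> nat \<Rightarrow> complex" where
  "levy_label = (\<lambda>(q, \<omega>). of_nat \<omega> * \<i> ^ q)"

definition levy_graph :: "(nat \<times> nat) labeled_digraph" where
  "levy_graph = (levy_digraph, levy_label)"

definition levy_digits :: "complex set" where
  "levy_digits = {0, 1, \<i>, -1, -\<i>}"

end

theory Submission
  imports Defs
begin

text \<open>
  Both maps have the form \<open>f\<^sub>\<omega> z = (\<omega> + \<i>\<^sup>\<omega> z) / (1 + \<i>)\<close> with \<open>\<omega> \<in> {0, 1}\<close>.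
  Since \<open>\<Lambda> = f\<^sub>0(\<Lambda>) \<union> f\<^sub>1(\<Lambda>)\<close>, every point of \<open>\<Lambda>\<close> is \<open>f\<^sub>\<omega>\<close> of another point of \<open>\<Lambda>\<close>; repeating
  this forever produces the digits of its expansion, because the remainder after \<open>n\<close> steps
  is a point of a bounded set times a number of modulus \<open>\<bar>1 + \<i>\<bar>\<^sup>-\<^sup>n\<close>
  (lemma \<open>levy_dragon_expansion\<close>). The exponent of \<open>\<i>\<close> in front of the digit \<open>\<omega>\<close> is the number of
  earlier choices of \<open>f\<^sub>1\<close>. Recorded modulo 4, this exponent is the first component of the
  current node, which is exactly the rule for the edges of the graph.

  An affine map \<open>z \<mapsto> l z + t\<close> acts on these expansions digit by digit. The factor \<open>l\<close> can be put
  into the digits, and so can the translation, because \<open>t\<close> is itself an expansion with constant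
  digit: \<open>\<Sum>\<^sub>n (1 + \<i>)\<^sup>-\<^sup>n = 1 / \<i>\<close>, hence \<open>t = \<Sum>\<^sub>n (1 + \<i>)\<^sup>-\<^sup>n \<i> t\<close>. So relabeling each node from \<open>d\<close> to
  \<open>l d + \<i> t\<close> gives the expansion of the image point, with the same base, the same path through
  the graph and the constant \<open>c = 1\<close> (lemma \<open>levy_affine_revolving_expansion\<close>).

  What remains is that \<open>\<Lambda>\<close> satisfies its defining equation at all, and that its affine image is
  an attractor. Both follow from Hutchinson's theorem that a finite family of contractions has
  exactly one nonempty compact invariant set (lemma \<open>hutchinson\<close>), the second because conjugation
  carries invariant sets to invariant sets.
\<close>

section \<open>Attractors of finite families of contractions\<close>

text \<open>The point of \<open>K\<close> that is farthest from \<open>L\<close> is the image of a point of \<open>K\<close> under a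
  contraction that maps \<open>L\<close> into itself. The preimage would lie even farther from \<open>L\<close>, unless
  the distance is zero.\<close>

lemma backward_invariant_subset_forward_invariant:
  fixes fs :: "('a::heine_borel \<Rightarrow> 'a) set"
  assumes contr: "\<forall>f\<in>fs. \<exists>r<1. r-lipschitz_on UNIV f"
    and K: "compact K" "K \<subseteq> (\<Union>f\<in>fs. f ` K)"
    and L: "compact L" "L \<noteq> {}" "(\<Union>f\<in>fs. f ` L) \<subseteq> L"
  shows "K \<subseteq> L"
proof (cases "K = {}")
  case False
  have "continuous_on K (\<lambda>x. infdist x L)"
    by (intro continuous_intros)
  then obtain x where x: "x \<in> K" "\<And>y. y \<in> K \<Longrightarrow> infdist y L \<le> infdist x L"
    using continuous_attains_sup[OF K(1) False] by blast
  obtain f y where f: "f \<in> fs" "y \<in> K" "x = f y"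
    using K(2) x(1) by blast
  obtain r where r: "r < 1" "r-lipschitz_on UNIV f"
    using contr f(1) by blast
  obtain z where z: "z \<in> L" "infdist y L = dist y z"
    using infdist_attains_inf[OF compact_imp_closed[OF L(1)] L(2)] by metis
  have "infdist x L \<le> dist (f y) (f z)"
    unfolding f(3) using L(3) f(1) z(1) by (intro infdist_le) blast
  also have "\<dots> \<le> r * infdist y L"
    using lipschitz_onD[OF r(2), of y z] z(2) by simp
  also have "\<dots> \<le> r * infdist x L"
    using x(2)[OF f(2)] lipschitz_on_nonneg[OF r(2)] by (rule mult_left_mono)
  finally have "(1 - r) * infdist x L \<le> 0"
    by (simp add: algebra_simps)
  then have "infdist x L \<le> 0"
    using r(1) by (simp add: mult_le_0_iff)
  then have "infdist y L = 0" if "y \<in> K" for y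
    using x(2)[OF that] infdist_nonneg[of y L] by linarith
  then show ?thesis
    using in_closed_iff_infdist_zero[OF compact_imp_closed[OF L(1)] L(2)] by blast
qed simp

text \<open>A ball around any point is mapped into itself by a contraction once it is large compared
  with the displacement of its center; finitely many contractions share such a ball.\<close>

lemma contractions_invariant_cball:
  fixes fs :: "('a::metric_space \<Rightarrow> 'a) set"
  assumes "finite fs" and contr: "\<forall>f\<in>fs. \<exists>r<1. r-lipschitz_on UNIV f"
  shows "\<exists>R\<ge>0. \<forall>f\<in>fs. f ` cball a R \<subseteq> cball a R"
proof -
  have "\<forall>f\<in>fs. \<forall>\<^sub>F R in at_top. f ` cball a R \<subseteq> cball a R"
  proof
    fix f assume "f \<in> fs"
    then obtain r where r: "r < 1" "r-lipschitz_on UNIV f"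
      using contr by blast
    have "f ` cball a R \<subseteq> cball a R" if "R \<ge> dist a (f a) / (1 - r)" for R
    proof
      fix y assume "y \<in> f ` cball a R"
      then obtain x where x: "y = f x" "dist a x \<le> R"
        by auto
      have "dist a (f x) \<le> dist a (f a) + dist (f a) (f x)"
        by (rule dist_triangle)
      also have "\<dots> \<le> (1 - r) * R + r * R"
      proof (rule add_mono)
        show "dist a (f a) \<le> (1 - r) * R"
          using that r(1) by (simp add: field_simps)
        have "dist (f a) (f x) \<le> r * dist a x"
          by (rule lipschitz_onD[OF r(2)]) auto
        also have "\<dots> \<le> r * R"
          using x(2) lipschitz_on_nonneg[OF r(2)] by (rule mult_left_mono)
        finally show "dist (f a) (f x) \<le> r * R" .
      qed
      finally show "y \<in> cball a R"
        by (simp add: x(1) algebra_simps)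
    qed
    then show "\<forall>\<^sub>F R in at_top. f ` cball a R \<subseteq> cball a R"
      by (auto simp: eventually_at_top_linorder)
  qed
  then have "\<forall>\<^sub>F R in at_top. (\<forall>f\<in>fs. f ` cball a R \<subseteq> cball a R) \<and> R \<ge> 0"
    using \<open>finite fs\<close> by (simp add: eventually_ball_finite eventually_conj eventually_ge_at_top)
  then show ?thesis
    by (auto simp: eventually_at_top_linorder)
qed

text \<open>The invariant set is the intersection of the decreasing images of an invariant ball.
  The nontrivial inclusion is a compactness argument: a point of the intersection has, at every
  stage, a preimage under one of the maps. As there are finitely many maps and the stages
  decrease, a single map serves all stages, and its compact sets of preimages are nested.\<close>

lemma contractions_invariant_compact:
  fixes fs :: "('a::heine_borel \<Rightarrow> 'a) set"
  assumes "finite fs" "fs \<noteq> {}" and contr: "\<forall>f\<in>fs. \<exists>r<1. r-lipschitz_on UNIV f"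
  shows "\<exists>K. K \<noteq> {} \<and> compact K \<and> K = (\<Union>f\<in>fs. f ` K)"
proof -
  define \<Phi> where "\<Phi> X = (\<Union>f\<in>fs. f ` X)" for X
  have \<Phi>_mono: "\<Phi> X \<subseteq> \<Phi> Y" if "X \<subseteq> Y" for X Y
    using that unfolding \<Phi>_def by blast
  have cont: "continuous_on X f" if "f \<in> fs" for f X
    using contr that lipschitz_on_continuous_on continuous_on_subset by (metis subset_UNIV)
  obtain a :: 'a and R where R: "R \<ge> 0" "\<Phi> (cball a R) \<subseteq> cball a R"
    using contractions_invariant_cball[OF assms(1) contr] unfolding \<Phi>_def by (meson UN_least)
  define F where "F n = (\<Phi> ^^ n) (cball a R)" for n
  have F_Suc: "F (Suc n) = \<Phi> (F n)" for n
    by (simp add: F_def)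
  have F_compact: "compact (F n)" for n
  proof (induction n)
    case (Suc n)
    then show ?case
      unfolding F_Suc \<Phi>_def using assms(1) cont by (intro compact_UN compact_continuous_image)
  qed (simp add: F_def)
  have F_ne: "F n \<noteq> {}" for n
  proof (induction n)
    case (Suc n)
    then show ?case
      unfolding F_Suc \<Phi>_def using assms(2) by auto
  qed (use R in \<open>simp add: F_def\<close>)
  have "F (Suc n) \<subseteq> F n" for n
  proof (induction n)
    case (Suc n)
    then show ?case
      unfolding F_Suc[of "Suc n"] F_Suc[of n] by (metis F_Suc \<Phi>_mono)
  qed (use R in \<open>simp add: F_def\<close>)
  then have F_dec: "F n \<subseteq> F m" if "m \<le> n" for m n
    using that by (rule lift_Suc_antimono_le)
  define K where "K = \<Inter> (range F)"
  have "K \<noteq> {}"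
    unfolding K_def using F_compact F_ne F_dec by (rule compact_nest)
  moreover have "compact K"
    unfolding K_def using F_compact by (intro compact_Inter) auto
  moreover have "K = (\<Union>f\<in>fs. f ` K)"
  proof
    show "(\<Union>f\<in>fs. f ` K) \<subseteq> K"
    proof -
      have "\<Phi> K \<subseteq> F n" for n
        using \<Phi>_mono[of K "F n"] F_Suc[of n] F_dec[of n "Suc n"] unfolding K_def by auto
      then show ?thesis
        unfolding K_def \<Phi>_def by blast
    qed
    show "K \<subseteq> (\<Union>f\<in>fs. f ` K)"
    proof
      fix x assume "x \<in> K"
      then have x: "\<exists>f\<in>fs. x \<in> f ` F n" for n
        using F_Suc[of n] unfolding K_def \<Phi>_def by blast
      have "\<exists>f\<in>fs. \<forall>n. x \<in> f ` F n"
      proof (rule ccontr)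
        assume "\<not> (\<exists>f\<in>fs. \<forall>n. x \<in> f ` F n)"
        then obtain m where m: "\<And>f. f \<in> fs \<Longrightarrow> x \<notin> f ` F (m f)"
          by metis
        obtain f where f: "f \<in> fs" "x \<in> f ` F (Max (m ` fs))"
          using x by blast
        have "m f \<le> Max (m ` fs)"
          using f(1) assms(1) by simp
        from F_dec[OF this] show False
          using m[OF f(1)] f(2) by blast
      qed
      then obtain f where f: "f \<in> fs" "\<And>n. x \<in> f ` F n"
        by blast
      have "closed (f -` {x})"
        using cont[OF f(1), of UNIV] by (simp add: continuous_on_closed_vimage)
      then have "compact (F n \<inter> f -` {x})" for n
        using F_compact by (intro compact_Int_closed)
      moreover have "F n \<inter> f -` {x} \<noteq> {}" for n
        using f(2)[of n] by auto
      moreover have "F n \<inter> f -` {x} \<subseteq> F m \<inter> f -` {x}" if "m \<le> n" for m n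
        using F_dec[OF that] by blast
      ultimately have "\<Inter> (range (\<lambda>n. F n \<inter> f -` {x})) \<noteq> {}"
        by (rule compact_nest)
      then show "x \<in> (\<Union>f\<in>fs. f ` K)"
        using f(1) unfolding K_def by auto
    qed
  qed
  ultimately show ?thesis
    by blast
qed

lemma hutchinson:
  fixes fs :: "('a::heine_borel \<Rightarrow> 'a) set"
  assumes "finite fs" "fs \<noteq> {}" "\<forall>f\<in>fs. \<exists>r<1. r-lipschitz_on UNIV f"
  shows "\<exists>!K. K \<noteq> {} \<and> compact K \<and> K = (\<Union>f\<in>fs. f ` K)"
proof (rule ex_ex1I)
  show "K = L" if "K \<noteq> {} \<and> compact K \<and> K = (\<Union>f\<in>fs. f ` K)"
    "L \<noteq> {} \<and> compact L \<and> L = (\<Union>f\<in>fs. f ` L)" for K L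
    using that backward_invariant_subset_forward_invariant[OF assms(3)]
    by (metis order_refl subset_antisym)
qed (rule contractions_invariant_compact[OF assms])

lemma attractor_props:
  assumes "planar_ifs fs"
  shows "attractor fs \<noteq> {}" "compact (attractor fs)"
    "attractor fs = (\<Union>f\<in>fs. f ` attractor fs)"
  using theI'[OF hutchinson[of fs]] assms unfolding planar_ifs_def attractor_def by auto

lemma attractor_eqI:
  assumes "planar_ifs fs" "K \<noteq> {}" "compact K" "K = (\<Union>f\<in>fs. f ` K)"
  shows "attractor fs = K"
  using the1_equality[OF hutchinson[of fs], of K] assms
  unfolding planar_ifs_def attractor_def by auto

section \<open>Affine images of attractors\<close>

definition affine_conj :: "complex \<Rightarrow> complex \<Rightarrow> (complex \<Rightarrow> complex) \<Rightarrow> complex \<Rightarrow> complex" where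
  "affine_conj l t f z = l * f ((z - t) / l) + t"

lemma planar_ifs_affine_conj:
  assumes "l \<noteq> 0" "planar_ifs fs"
  shows "planar_ifs (affine_conj l t ` fs)"
proof -
  have "r-lipschitz_on UNIV (affine_conj l t f)" if "r-lipschitz_on UNIV f" for f r
  proof (rule lipschitz_onI)
    fix x y
    have "dist (affine_conj l t f x) (affine_conj l t f y)
        = cmod l * dist (f ((x - t) / l)) (f ((y - t) / l))"
      by (simp add: affine_conj_def dist_norm flip: norm_mult right_diff_distrib)
    also have "\<dots> \<le> cmod l * (r * dist ((x - t) / l) ((y - t) / l))"
      by (intro mult_left_mono lipschitz_onD[OF that]) auto
    also have "dist ((x - t) / l) ((y - t) / l) = dist x y / cmod l"
      by (simp add: dist_norm flip: diff_divide_distrib norm_divide)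
    finally show "dist (affine_conj l t f x) (affine_conj l t f y) \<le> r * dist x y"
      using assms(1) by simp
  qed (rule lipschitz_on_nonneg[OF that])
  then show ?thesis
    using assms(2) unfolding planar_ifs_def by blast
qed

lemma attractor_affine_conj:
  assumes "l \<noteq> 0" "planar_ifs fs"
  shows "attractor (affine_conj l t ` fs) = (\<lambda>z. l * z + t) ` attractor fs"
proof (rule attractor_eqI)
  let ?S = "\<lambda>z. l * z + t" and ?A = "attractor fs"
  note A = attractor_props[OF assms(2)]
  show "planar_ifs (affine_conj l t ` fs)"
    using assms by (rule planar_ifs_affine_conj)
  show "?S ` ?A \<noteq> {}"
    using A(1) by simp
  show "compact (?S ` ?A)"
    using A(2) by (intro compact_continuous_image continuous_intros)
  have conj: "affine_conj l t f ` ?S ` ?A = ?S ` f ` ?A" for f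
    using assms(1) by (simp add: image_image affine_conj_def)
  have "?S ` ?A = ?S ` (\<Union>f\<in>fs. f ` ?A)"
    using A(3) by simp
  also have "\<dots> = (\<Union>g\<in>affine_conj l t ` fs. g ` ?S ` ?A)"
    by (simp add: image_UN conj)
  finally show "?S ` ?A = (\<Union>g\<in>affine_conj l t ` fs. g ` ?S ` ?A)" .
qed

section \<open>Expansions of the points of the dragon\<close>

lemma levy_maps_eq:
  "levy_f0 z = z / (1 + \<i>)" "levy_f1 z = (1 + \<i> * z) / (1 + \<i>)"
proof -
  have "1 / (1 + \<i>) = (1 - \<i>) / 2"
    by (simp add: complex_eq_iff Re_divide Im_divide)
  then have inv: "w / (1 + \<i>) = w * ((1 - \<i>) / 2)" for w
    by (metis mult.right_neutral times_divide_eq_right)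
  show "levy_f0 z = z / (1 + \<i>)"
    by (simp add: inv levy_f0_def)
  show "levy_f1 z = (1 + \<i> * z) / (1 + \<i>)"
    unfolding inv levy_f1_def by (simp add: complex_eq_iff field_simps)
qed

lemma norm_one_plus_ii: "cmod (1 + \<i>) = sqrt 2"
  by (simp add: cmod_def)

lemma one_plus_ii_neq_0: "1 + \<i> \<noteq> 0"
  by (simp add: complex_eq_iff)

lemma planar_ifs_levy: "planar_ifs {levy_f0, levy_f1}"
proof -
  have "(1 / sqrt 2)-lipschitz_on UNIV levy_f0"
    by (rule lipschitz_onI)
      (simp_all add: levy_maps_eq dist_norm norm_divide norm_one_plus_ii flip: diff_divide_distrib)
  moreover have "(1 / sqrt 2)-lipschitz_on UNIV levy_f1"
    by (rule lipschitz_onI)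
      (simp_all add: levy_maps_eq dist_norm norm_divide norm_mult norm_one_plus_ii
        flip: diff_divide_distrib right_diff_distrib)
  moreover have "1 / sqrt 2 < (1::real)"
    by simp
  ultimately show ?thesis
    unfolding planar_ifs_def by blast
qed

text \<open>Iterating \<open>x = (\<omega> + \<i>\<^sup>\<omega> x') / (1 + \<i>)\<close> writes \<open>x\<close> as a partial sum plus a remainder
  \<open>\<i>\<^sup>q x\<^sub>n / (1 + \<i>)\<^sup>n\<close> with \<open>x\<^sub>n\<close> in the bounded set \<open>\<Lambda>\<close>.\<close>

lemma levy_dragon_expansion:
  assumes "x \<in> levy_dragon"
  obtains \<omega> :: "nat \<Rightarrow> nat" where "\<And>n. \<omega> n \<in> {0, 1}"
    "(\<lambda>n. of_nat (\<omega> n) * \<i> ^ (\<Sum>k<n. \<omega> k) / (1 + \<i>) ^ Suc n) sums x"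
proof -
  note A = attractor_props[OF planar_ifs_levy, folded levy_dragon_def]
  have "\<exists>w y. w \<in> {0, 1} \<and> y \<in> levy_dragon \<and> z = (of_nat w + \<i> ^ w * y) / (1 + \<i>)"
    if z: "z \<in> levy_dragon" for z
  proof -
    have "z \<in> levy_f0 ` levy_dragon \<union> levy_f1 ` levy_dragon"
      using z A(3) by simp
    then consider y where "y \<in> levy_dragon" "z = levy_f0 y"
      | y where "y \<in> levy_dragon" "z = levy_f1 y"
      by blast
    then show ?thesis
    proof cases
      case (1 y)
      then show ?thesis
        by (intro exI[of _ 0] exI[of _ y]) (simp add: levy_maps_eq)
    next
      case (2 y)
      then show ?thesis
        by (intro exI[of _ 1] exI[of _ y]) (simp add: levy_maps_eq)
    qed
  qed
  then obtain w :: "complex \<Rightarrow> nat" and y where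
    wy: "\<And>z. z \<in> levy_dragon \<Longrightarrow> w z \<in> {0, 1} \<and> y z \<in> levy_dragon
        \<and> z = (of_nat (w z) + \<i> ^ w z * y z) / (1 + \<i>)"
    by metis
  define X where "X n = (y ^^ n) x" for n
  define \<omega> where "\<omega> n = w (X n)" for n
  have X: "X n \<in> levy_dragon" for n
    by (induction n) (use assms wy in \<open>auto simp: X_def\<close>)
  have step: "X n = (of_nat (\<omega> n) + \<i> ^ \<omega> n * X (Suc n)) / (1 + \<i>)" for n
    using wy[OF X[of n]] by (simp add: \<omega>_def X_def)
  let ?d = "\<lambda>n. of_nat (\<omega> n) * \<i> ^ (\<Sum>k<n. \<omega> k) / (1 + \<i>) ^ Suc n"
  let ?e = "\<lambda>n. \<i> ^ (\<Sum>k<n. \<omega> k) * X n / (1 + \<i>) ^ n"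
  have partial: "(\<Sum>k<n. ?d k) = x - ?e n" for n
  proof (induction n)
    case (Suc n)
    have "?e n = \<i> ^ (\<Sum>k<n. \<omega> k) * ((of_nat (\<omega> n) + \<i> ^ \<omega> n * X (Suc n)) / (1 + \<i>)) / (1 + \<i>) ^ n"
      using step[of n] by simp
    also have "\<dots> = ?d n + ?e (Suc n)"
      by (simp add: power_add add_divide_distrib distrib_left mult_ac)
    finally show ?case
      using Suc by simp
  qed (simp add: X_def)
  obtain B where B: "\<And>z. z \<in> levy_dragon \<Longrightarrow> cmod z \<le> B"
    using compact_imp_bounded[OF A(2)] unfolding bounded_iff by blast
  have "?e \<longlonglongrightarrow> 0"
  proof (rule Lim_null_comparison)
    have "(\<lambda>n. B * (1 / sqrt 2) ^ n) \<longlonglongrightarrow> B * 0"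
      by (intro tendsto_intros LIMSEQ_power_zero) simp
    then show "(\<lambda>n. B * (1 / sqrt 2) ^ n) \<longlonglongrightarrow> 0"
      by simp
    show "\<forall>\<^sub>F n in sequentially. cmod (?e n) \<le> B * (1 / sqrt 2) ^ n"
      by (intro always_eventually allI)
        (simp add: norm_mult norm_divide norm_power norm_one_plus_ii power_divide divide_right_mono B X)
  qed
  then have "?d sums x"
    unfolding sums_def partial using tendsto_diff[OF tendsto_const[of x]] by fastforce
  moreover have "\<omega> n \<in> {0, 1}" for n
    using wy[OF X[of n]] by (simp add: \<omega>_def)
  ultimately show ?thesis
    using that by blast
qed

text \<open>The geometric series behind the claim that a translation by \<open>t\<close> adds the constant
  \<open>\<i> t\<close> to every digit.\<close>

lemma constant_digit_sums: "(\<lambda>n. \<i> * t / (1 + \<i>) ^ Suc n) sums t"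
proof -
  have "cmod (1 / (1 + \<i>)) < 1"
    by (simp add: norm_divide norm_one_plus_ii)
  from sums_mult[OF geometric_sums[OF this], of "\<i> * t / (1 + \<i>)"]
  have "(\<lambda>n. \<i> * t / (1 + \<i>) ^ Suc n) sums (\<i> * t / (1 + \<i>) * (1 / (1 - 1 / (1 + \<i>))))"
    by (simp add: power_divide mult_ac)
  also have "1 / (1 - 1 / (1 + \<i>)) = (1 + \<i>) / \<i>"
    using one_plus_ii_neq_0 by (simp add: field_simps)
  also have "\<i> * t / (1 + \<i>) * ((1 + \<i>) / \<i>) = t"
    using one_plus_ii_neq_0 by (simp add: mult.commute[of t \<i>])
  finally show ?thesis .
qed

section \<open>The revolving structure\<close>

definition affine_label :: "complex \<Rightarrow> complex \<Rightarrow> nat \<times> nat \<Rightarrow> complex" where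
  "affine_label l t v = l * levy_label v + \<i> * t"

lemma ii_power_mod_4: "\<i> ^ (n mod 4) = \<i> ^ n"
proof -
  have "\<i> ^ n = \<i> ^ (4 * (n div 4) + n mod 4)"
    by simp
  also have "\<dots> = (\<i> ^ 4) ^ (n div 4) * \<i> ^ (n mod 4)"
    by (simp only: power_add power_mult)
  also have "\<i> ^ 4 = 1"
    by (simp add: power4_eq_xxxx)
  finally show ?thesis
    by simp
qed

lemma pair_fin_digraph_levy: "pair_fin_digraph levy_digraph"
proof
  show fin: "finite (pverts levy_digraph)"
    by (simp add: levy_digraph_def)
  have sub: "parcs levy_digraph \<subseteq> pverts levy_digraph \<times> pverts levy_digraph"
    by (auto simp: levy_digraph_def)
  then show "finite (parcs levy_digraph)"
    using fin finite_subset by blast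
  show "fst e \<in> pverts levy_digraph" "snd e \<in> pverts levy_digraph"
    if "e \<in> parcs levy_digraph" for e
    using that sub by auto
qed

lemma levy_label_in_digits:
  assumes "v \<in> pverts levy_digraph"
  shows "levy_label v \<in> levy_digits"
proof -
  obtain q \<omega> where v: "v = (q, \<omega>)" "q < 4" "\<omega> \<in> {0, 1}"
    using assms by (auto simp: levy_digraph_def)
  have "q \<in> {0, 1, 2, 3}"
    using v(2) by auto
  then show ?thesis
    using v(3) by (auto simp: v(1) levy_label_def levy_digits_def power3_eq_cube)
qed

lemma levy_affine_revolving_expansion:
  assumes x: "x \<in> levy_dragon" and "finite D"
    and D: "\<And>v. v \<in> pverts levy_digraph \<Longrightarrow> affine_label l t v \<in> D"
  shows "revolving_expansion 1 (1 + \<i>) D (levy_digraph, affine_label l t) (l * x + t)"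
proof -
  obtain \<omega> :: "nat \<Rightarrow> nat" where \<omega>: "\<And>n. \<omega> n \<in> {0, 1}"
    and x_sums: "(\<lambda>n. of_nat (\<omega> n) * \<i> ^ (\<Sum>k<n. \<omega> k) / (1 + \<i>) ^ Suc n) sums x"
    using levy_dragon_expansion[OF x] by metis
  define v where "v n = ((\<Sum>k<n. \<omega> k) mod 4, \<omega> n)" for n
  have v: "v n \<in> pverts levy_digraph" for n
    using \<omega>[of n] by (simp add: v_def levy_digraph_def)
  have edge: "(v n, v (Suc n)) \<in> parcs levy_digraph" for n
    using \<omega>[of n] \<omega>[of "Suc n"] by (simp add: v_def levy_digraph_def mod_add_left_eq)
  have "(\<lambda>n. l * (of_nat (\<omega> n) * \<i> ^ (\<Sum>k<n. \<omega> k) / (1 + \<i>) ^ Suc n) + \<i> * t / (1 + \<i>) ^ Suc n)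
      sums (l * x + t)"
    by (intro sums_add sums_mult x_sums constant_digit_sums)
  then have "(\<lambda>n. affine_label l t (v n) / (1 + \<i>) ^ Suc n) sums (l * x + t)"
    by (simp add: affine_label_def levy_label_def v_def ii_power_mod_4 add_divide_distrib)
  moreover have "affine_label l t (v n) \<in> D" for n
    using v by (rule D)
  moreover have "affine_label l t \<in> pverts levy_digraph \<rightarrow> D"
    using D by (rule Pi_I)
  ultimately show ?thesis
    unfolding revolving_expansion_def prod.case
    using one_plus_ii_neq_0 \<open>finite D\<close> pair_fin_digraph_levy v edge
    by (intro conjI exI[of _ "\<lambda>n. affine_label l t (v n)"] exI[of _ v] allI)
      (simp_all only: sums_iff mult_1 refl not_False_eq_True)
qed

lemma has_revolving_structure_affine_levy_dragon:
  assumes "l \<noteq> 0" "finite D"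
    and "\<And>v. v \<in> pverts levy_digraph \<Longrightarrow> affine_label l t v \<in> D"
  shows "has_revolving_structure ((\<lambda>z. l * z + t) ` levy_dragon) (1 + \<i>) D
    (levy_digraph, affine_label l t)"
  unfolding has_revolving_structure_def
proof
  show "\<exists>fs. planar_ifs fs \<and> (\<lambda>z. l * z + t) ` levy_dragon = attractor fs"
    unfolding levy_dragon_def
    using planar_ifs_affine_conj[OF assms(1) planar_ifs_levy]
      attractor_affine_conj[OF assms(1) planar_ifs_levy] by metis
  show "\<exists>c. \<forall>x\<in>(\<lambda>z. l * z + t) ` levy_dragon.
      revolving_expansion c (1 + \<i>) D (levy_digraph, affine_label l t) x"
    using levy_affine_revolving_expansion[OF _ assms(2,3)] by blast
qed

theorem theorem1p3:
  fixes S :: "complex \<Rightarrow> complex" and l t :: complex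
  assumes "l \<noteq> 0"
    and "S = (\<lambda>z. l * z + t)"
  shows "\<exists>b D (\<G> :: (nat \<times> nat) labeled_digraph).
    has_revolving_structure (S ` levy_dragon) b D \<G> \<and>
    same_revolving_pattern levy_dragon (1 + \<i>) levy_digits levy_graph
      (S ` levy_dragon) b D \<G>"
proof -
  let ?D = "affine_label l t ` pverts levy_digraph"
  let ?G = "(levy_digraph, affine_label l t)"
  have "finite ?D"
    using pair_fin_digraph_levy by (simp add: levy_digraph_def)
  then have S: "has_revolving_structure (S ` levy_dragon) (1 + \<i>) ?D ?G"
    unfolding assms(2) using assms(1)
    by (intro has_revolving_structure_affine_levy_dragon) auto
  have "finite levy_digits"
    by (simp add: levy_digits_def)
  have id_label: "affine_label 1 0 = levy_label"
    by (simp add: affine_label_def fun_eq_iff)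
  have "has_revolving_structure ((\<lambda>z. 1 * z + 0) ` levy_dragon) (1 + \<i>) levy_digits
      (levy_digraph, affine_label 1 0)"
    using levy_label_in_digits
    by (intro has_revolving_structure_affine_levy_dragon)
      (simp_all add: id_label \<open>finite levy_digits\<close>)
  then have "has_revolving_structure levy_dragon (1 + \<i>) levy_digits levy_graph"
    by (simp add: id_label levy_graph_def)
  with S have "same_revolving_pattern levy_dragon (1 + \<i>) levy_digits levy_graph
      (S ` levy_dragon) (1 + \<i>) ?D ?G"
    by (simp add: same_revolving_pattern_def levy_graph_def)
  with S show ?thesis
    by blast
qed

end
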